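(* Let $G=(V,E)$ be a connected finite graph and let $h\in C(V)$ be a positive function. Then for any $\rho\in(-\infty,0)\cup(0,+\infty)$ and any $s\in(0,1)$, the functional $J_\rho:\mathscr{H}\to\mathbb{R}$, $$J_\rho(u)=\frac12\int_V|\nabla^s u|^2d\mu-\rho\log\int_V he^u d\mu,$$ where $\mathscr{H}=\{u\in W^{s,2}(V):\int_V u\,d\mu=0\}$, has a minimizer $u\in\mathscr{H}$. Moreover, the mean field equation $$(-\Delta)^s u=\rho\left(\frac{he^u}{\int_V he^u d\mu}-\frac{1}{|V|}\right)\quad\text{for all } x\in V$$ has a solution $u\in\mathscr{H}$.
   Context: Setting: $G=(V,E)$ is a finite graph (finite vertex set $V$, $n=\sharp V\ge 2$) that is simple (no loops or multiple edges), undirected and connected, with a positive vertex measure $\mu:V\to(0,+\infty)$ and positive symmetric edge weights $w_{xy}=w_{yx}>0$ for $xy\in E$. $C(V)$ is the set of all functions $V\to\mathbb{R}$; $\int_V u\,d\mu=\sum_{x\in V}\mu(x)u(x)$; $|V|=\sum_{x\in V}\mu(x)$. The Laplacian is $\Delta u(x)=\frac1{\mu(x)}\sum_{y\sim x}w_{xy}(u(y)-u(x))$. The eigenvalues of $-\Delta$ are $0=\lambda_0<\lambda_1\le\cdots\le\lambda_{n-1}$, with eigenfunctions $\phi_0,\dots,\phi_{n-1}$ orthonormal for $\langle u,v\rangle=\sum_{x\in V}\mu(x)u(x)v(x)$. For $s\in(0,1)$ and $x\ne y$ put $W_s(x,y)=-\mu(x)\mu(y)\sum_{i=0}^{n-1}\lambda_i^s\phi_i(x)\phi_i(y)$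 (with $\lambda_0^s=0$); one has $0<W_s(x,y)=W_s(y,x)<+\infty$. The fractional Laplacian is $$(-\Delta)^s u(x)=\frac{1}{\mu(x)}\sum_{y\in V,\,y\ne x}W_s(x,y)(u(x)-u(y)),$$ and $|\nabla^s u|^2(x)=\frac{1}{2\mu(x)}\sum_{y\in V,\,y\neq x}W_s(x,y)(u(x)-u(y))^2$. $W^{s,2}(V)$ is the set of $u\in C(V)$ with $\int_V(|\nabla^s u|^2+|u|^2)d\mu<+\infty$; since $V$ is finite, $W^{s,2}(V)=C(V)$. *)

theory Defs
  imports "HOL-Analysis.Analysis"
begin

text \<open>
  The vertex set is the universe of a finite type \<open>'v\<close>, so \<open>C(V)\<close> is the full function type
  \<open>'v \<Rightarrow> real\<close>. The weight function \<open>w\<close> is only constrained, and only ever used, on edges.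
\<close>

locale weighted_graph =
  fixes adj :: "'v::finite \<Rightarrow> 'v \<Rightarrow> bool"
    and \<mu> :: "'v \<Rightarrow> real"
    and w :: "'v \<Rightarrow> 'v \<Rightarrow> real"
  assumes card_ge_2: "CARD('v) \<ge> 2"
    and undirected: "symp adj"
    and no_loops: "irreflp adj"
    and connected: "\<And>x y. adj\<^sup>*\<^sup>* x y"
    and measure_pos: "\<And>x. \<mu> x > 0"
    and weight_pos: "\<And>x y. adj x y \<Longrightarrow> w x y > 0"
    and weight_sym: "\<And>x y. adj x y \<Longrightarrow> w x y = w y x"

definition vertex_integral :: "('v::finite \<Rightarrow> real) \<Rightarrow> ('v \<Rightarrow> real) \<Rightarrow> real" where
  "vertex_integral \<mu> u = (\<Sum>x\<in>UNIV. \<mu> x * u x)"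

definition total_volume :: "('v::finite \<Rightarrow> real) \<Rightarrow> real" where
  "total_volume \<mu> = (\<Sum>x\<in>UNIV. \<mu> x)"

definition vertex_inner :: "('v::finite \<Rightarrow> real) \<Rightarrow> ('v \<Rightarrow> real) \<Rightarrow> ('v \<Rightarrow> real) \<Rightarrow> real" where
  "vertex_inner \<mu> u v = (\<Sum>x\<in>UNIV. \<mu> x * u x * v x)"

definition laplacian ::
  "('v::finite \<Rightarrow> 'v \<Rightarrow> bool) \<Rightarrow> ('v \<Rightarrow> real) \<Rightarrow> ('v \<Rightarrow> 'v \<Rightarrow> real) \<Rightarrow> ('v \<Rightarrow> real) \<Rightarrow> 'v \<Rightarrow> real" where
  "laplacian adj \<mu> w u x = 1 / \<mu> x * (\<Sum>y | adj x y. w x y * (u y - u x))"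

text \<open>
  \<open>eigensystem adj \<mu> w lam \<phi>\<close>: the values \<open>lam 0 \<le> \<dots> \<le> lam (n - 1)\<close>, \<open>n = CARD('v)\<close>, are the
  eigenvalues of \<open>-\<Delta>\<close> counted with multiplicity, and \<open>\<phi> 0, \<dots>, \<phi> (n - 1)\<close> are corresponding
  orthonormal eigenfunctions. Values at indices \<open>\<ge> n\<close> are irrelevant. That \<open>0 = lam 0 < lam 1\<close> is a
  consequence for connected graphs and is not assumed; existence is \<open>eigensystem_exists\<close> below.
\<close>

definition eigensystem ::
  "('v::finite \<Rightarrow> 'v \<Rightarrow> bool) \<Rightarrow> ('v \<Rightarrow> real) \<Rightarrow> ('v \<Rightarrow> 'v \<Rightarrow> real) \<Rightarrow>
    (nat \<Rightarrow> real) \<Rightarrow> (nat \<Rightarrow> 'v \<Rightarrow> real) \<Rightarrow> bool" where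
  "eigensystem adj \<mu> w lam \<phi> \<longleftrightarrow>
     mono_on {..<CARD('v)} lam \<and>
     (\<forall>i<CARD('v). \<forall>x. - laplacian adj \<mu> w (\<phi> i) x = lam i * \<phi> i x) \<and>
     (\<forall>i<CARD('v). \<forall>j<CARD('v). vertex_inner \<mu> (\<phi> i) (\<phi> j) = (if i = j then 1 else 0))"

text \<open>
  Only the off-diagonal values \<open>frac_weight \<mu> lam \<phi> s x y\<close>, \<open>x \<noteq> y\<close>, are meaningful. Since
  \<open>0 powr s = 0\<close>, the convention \<open>lam 0 powr s = 0\<close> is built in.
\<close>

definition frac_weight ::
  "('v::finite \<Rightarrow> real) \<Rightarrow> (nat \<Rightarrow> real) \<Rightarrow> (nat \<Rightarrow> 'v \<Rightarrow> real) \<Rightarrow> real \<Rightarrow> 'v \<Rightarrow> 'v \<Rightarrow> real" where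
  "frac_weight \<mu> lam \<phi> s x y =
     - \<mu> x * \<mu> y * (\<Sum>i<CARD('v). lam i powr s * \<phi> i x * \<phi> i y)"

definition frac_laplacian ::
  "('v::finite \<Rightarrow> real) \<Rightarrow> (nat \<Rightarrow> real) \<Rightarrow> (nat \<Rightarrow> 'v \<Rightarrow> real) \<Rightarrow> real \<Rightarrow>
    ('v \<Rightarrow> real) \<Rightarrow> 'v \<Rightarrow> real" where
  "frac_laplacian \<mu> lam \<phi> s u x =
     1 / \<mu> x * (\<Sum>y | y \<noteq> x. frac_weight \<mu> lam \<phi> s x y * (u x - u y))"

definition frac_grad_sq ::
  "('v::finite \<Rightarrow> real) \<Rightarrow> (nat \<Rightarrow> real) \<Rightarrow> (nat \<Rightarrow> 'v \<Rightarrow> real) \<Rightarrow> real \<Rightarrow>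
    ('v \<Rightarrow> real) \<Rightarrow> 'v \<Rightarrow> real" where
  "frac_grad_sq \<mu> lam \<phi> s u x =
     1 / (2 * \<mu> x) * (\<Sum>y | y \<noteq> x. frac_weight \<mu> lam \<phi> s x y * (u x - u y)\<^sup>2)"

text \<open>As the vertex set is finite, the finiteness condition always holds.\<close>

definition frac_sobolev ::
  "('v::finite \<Rightarrow> real) \<Rightarrow> (nat \<Rightarrow> real) \<Rightarrow> (nat \<Rightarrow> 'v \<Rightarrow> real) \<Rightarrow> real \<Rightarrow> ('v \<Rightarrow> real) set" where
  "frac_sobolev \<mu> lam \<phi> s =
     {u. ereal (vertex_integral \<mu> (\<lambda>x. frac_grad_sq \<mu> lam \<phi> s u x + \<bar>u x\<bar>\<^sup>2)) < \<infinity>}"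

definition mean_zero_sobolev ::
  "('v::finite \<Rightarrow> real) \<Rightarrow> (nat \<Rightarrow> real) \<Rightarrow> (nat \<Rightarrow> 'v \<Rightarrow> real) \<Rightarrow> real \<Rightarrow> ('v \<Rightarrow> real) set" where
  "mean_zero_sobolev \<mu> lam \<phi> s = {u \<in> frac_sobolev \<mu> lam \<phi> s. vertex_integral \<mu> u = 0}"

definition J_functional ::
  "('v::finite \<Rightarrow> real) \<Rightarrow> (nat \<Rightarrow> real) \<Rightarrow> (nat \<Rightarrow> 'v \<Rightarrow> real) \<Rightarrow> real \<Rightarrow>
    ('v \<Rightarrow> real) \<Rightarrow> real \<Rightarrow> ('v \<Rightarrow> real) \<Rightarrow> real" where
  "J_functional \<mu> lam \<phi> s h \<rho> u =
     1 / 2 * vertex_integral \<mu> (frac_grad_sq \<mu> lam \<phi> s u)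
       - \<rho> * ln (vertex_integral \<mu> (\<lambda>x. h x * exp (u x)))"

text \<open>
  Existence of an eigensystem, by diagonalising the symmetric operator
  \<open>\<mu>\<^sup>1\<^sup>/\<^sup>2 (-\<Delta>) \<mu>\<^sup>-\<^sup>1\<^sup>/\<^sup>2\<close> on Euclidean space.
\<close>

lemma self_adjoint_min_eigenvector:
  fixes f :: "'a::euclidean_space \<Rightarrow> 'a"
  assumes lin: "linear f" and sym: "\<And>x y. f x \<bullet> y = x \<bullet> f y"
    and S: "subspace S" "f ` S \<subseteq> S" "S \<noteq> {0}"
  obtains e m where "e \<in> S" "norm e = 1" "f e = m *\<^sub>R e" "\<And>v. v \<in> S \<Longrightarrow> m * (v \<bullet> v) \<le> v \<bullet> f v"
proof -
  interpret linear f by fact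
  have S0: "0 \<in> S" using S(1) by (rule subspace_0)
  let ?K = "S \<inter> sphere 0 1"
  have "compact ?K"
    using closed_subspace[OF S(1)] by (intro closed_Int_compact) auto
  moreover have "?K \<noteq> {}"
  proof -
    obtain v where v: "v \<in> S" "v \<noteq> 0" using S(3) S0 by blast
    then have "(1 / norm v) *\<^sub>R v \<in> ?K" using S(1) by (simp add: subspace_scale)
    then show ?thesis by blast
  qed
  moreover have "continuous_on ?K (\<lambda>v. v \<bullet> f v)"
    by (intro continuous_intros linear_continuous_on linear_conv_bounded_linear[THEN iffD1] lin)
  ultimately obtain e where e: "e \<in> ?K" "\<And>v. v \<in> ?K \<Longrightarrow> e \<bullet> f e \<le> v \<bullet> f v"
    by (meson continuous_attains_inf)
  define m where "m = e \<bullet> f e"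
  have eS: "e \<in> S" and ne: "norm e = 1" using e(1) by auto
  have ee: "e \<bullet> e = 1" using ne by (simp add: norm_eq_1)
  have low: "m * (v \<bullet> v) \<le> v \<bullet> f v" if v: "v \<in> S" for v
  proof (cases "v = 0")
    case True
    then show ?thesis by (simp add: zero)
  next
    case False
    have "(1 / norm v) *\<^sub>R v \<in> ?K" using S(1) v False by (simp add: subspace_scale)
    from e(2)[OF this] have "m \<le> (v \<bullet> f v) / (v \<bullet> v)"
      by (simp add: m_def scale dot_square_norm power2_eq_square)
    then show ?thesis using False by (simp add: field_simps)
  qed
  define y where "y = f e - m *\<^sub>R e"
  have yS: "y \<in> S"
    using S eS by (auto simp: y_def intro!: subspace_diff subspace_scale)
  define c where "c = y \<bullet> f y - m * (y \<bullet> y)"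
  define b where "b = y \<bullet> y"
  have c0: "c \<ge> 0" using low[OF yS] by (simp add: c_def)
  have q: "0 \<le> 2 * t * b + t\<^sup>2 * c" for t
  proof -
    have "e + t *\<^sub>R y \<in> S" using S(1) eS yS by (simp add: subspace_add subspace_scale)
    moreover have "e \<bullet> f y = f e \<bullet> y" "y \<bullet> f e = f e \<bullet> y" "y \<bullet> e = e \<bullet> y" "e \<bullet> f e = m"
      using sym[of e y] by (simp_all add: inner_commute m_def)
    ultimately have
      "m * (1 + 2 * t * (e \<bullet> y) + t\<^sup>2 * (y \<bullet> y)) \<le> m + 2 * t * (f e \<bullet> y) + t\<^sup>2 * (y \<bullet> f y)"
      using low[of "e + t *\<^sub>R y"]
      by (simp add: add scale inner_add_left inner_add_right ee power2_eq_square algebra_simps)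
    moreover have "f e \<bullet> y = b + m * (e \<bullet> y)"
      unfolding b_def by (subst (2) y_def) (simp add: inner_diff_left)
    ultimately show ?thesis by (simp add: c_def algebra_simps)
  qed
  have "b = 0"
  proof -
    define r where "r = b / (1 + c)"
    have b: "b = r * (1 + c)" using c0 by (simp add: r_def)
    have "0 \<le> 2 * (- r) * b + (- r)\<^sup>2 * c" by (rule q)
    also have "\<dots> = - (r\<^sup>2 * (2 + c))" by (simp add: b power2_eq_square algebra_simps)
    finally have "r = 0" using c0 by (simp add: mult_le_0_iff)
    then show ?thesis by (simp add: b)
  qed
  then have "f e = m *\<^sub>R e" by (simp add: b_def y_def)
  with that eS ne low show ?thesis by blast
qed

lemma self_adjoint_eigenbasis:
  fixes f :: "'a::euclidean_space \<Rightarrow> 'a"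
  assumes lin: "linear f" and sym: "\<And>x y. f x \<bullet> y = x \<bullet> f y"
    and S: "subspace S" "f ` S \<subseteq> S" "dim S = k"
  shows "\<exists>e l. mono_on {..<k} l \<and> (\<forall>i<k. e i \<in> S \<and> f (e i) = l i *\<^sub>R e i) \<and>
    (\<forall>i<k. \<forall>j<k. e i \<bullet> e j = (if i = j then 1 else (0::real)))"
  using S
proof (induction k arbitrary: S)
  case 0
  show ?case by (auto simp: mono_on_def)
next
  case (Suc k)
  have "S \<noteq> {0}" using Suc.prems(3) by auto
  then obtain e0 m where e0: "e0 \<in> S" "norm e0 = 1" "f e0 = m *\<^sub>R e0"
    and low: "\<And>v. v \<in> S \<Longrightarrow> m * (v \<bullet> v) \<le> v \<bullet> f v"
    by (rule self_adjoint_min_eigenvector[OF lin sym Suc.prems(1,2)]) (rule that)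
  have ee: "e0 \<bullet> e0 = 1" using e0(2) by (simp add: norm_eq_1)
  let ?T = "S \<inter> {x. e0 \<bullet> x = 0}"
  have T: "subspace ?T" by (intro subspace_inter Suc.prems(1) subspace_hyperplane)
  have fT: "f ` ?T \<subseteq> ?T"
  proof
    fix z assume "z \<in> f ` ?T"
    then obtain y where y: "y \<in> S" "e0 \<bullet> y = 0" "z = f y" by blast
    have "e0 \<bullet> z = m * (e0 \<bullet> y)" unfolding y(3) sym[symmetric] e0(3) by simp
    then show "z \<in> ?T" using y Suc.prems(2) by auto
  qed
  have "span (insert e0 ?T) = S"
  proof
    show "span (insert e0 ?T) \<subseteq> S"
      using e0(1) by (intro span_minimal Suc.prems(1)) auto
    show "S \<subseteq> span (insert e0 ?T)"
    proof
      fix x assume x: "x \<in> S"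
      have "x - (e0 \<bullet> x) *\<^sub>R e0 \<in> ?T"
        using x e0(1) Suc.prems(1) by (simp add: subspace_diff subspace_scale inner_diff_right ee)
      then show "x \<in> span (insert e0 ?T)"
        unfolding span_breakdown_eq by (intro exI[of _ "e0 \<bullet> x"] span_base)
    qed
  qed
  then have "dim (insert e0 ?T) = Suc k" using Suc.prems(3) by (metis dim_span)
  moreover have "e0 \<notin> span ?T" unfolding span_eq_iff[THEN iffD2, OF T] using ee by simp
  ultimately have "dim ?T = k" by (simp add: dim_insert)
  from Suc.IH[OF T fT this] obtain e l where el: "mono_on {..<k} l"
    "\<And>i. i < k \<Longrightarrow> e i \<in> ?T \<and> f (e i) = l i *\<^sub>R e i"
    "\<And>i j. i < k \<Longrightarrow> j < k \<Longrightarrow> e i \<bullet> e j = (if i = j then 1 else (0::real))" by blast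
  have ml: "m \<le> l i" if "i < k" for i
    using low[of "e i"] el(2,3)[OF that] that by simp
  have mono: "mono_on {..<Suc k} (case_nat m l)"
    using ml el(1) by (auto simp: mono_on_def split: nat.split)
  show ?case
  proof (intro exI conjI)
    show "mono_on {..<Suc k} (case_nat m l)" by (rule mono)
    show "\<forall>i<Suc k. case_nat e0 e i \<in> S \<and>
        f (case_nat e0 e i) = case_nat m l i *\<^sub>R case_nat e0 e i"
      using e0 el(2) by (auto split: nat.split)
    show "\<forall>i<Suc k. \<forall>j<Suc k. case_nat e0 e i \<bullet> case_nat e0 e j = (if i = j then 1 else 0)"
      using ee el(2,3) by (auto split: nat.split simp: inner_commute)
  qed
qed

lemma (in weighted_graph) eigensystem_exists: "\<exists>lam \<phi>. eigensystem adj \<mu> w lam \<phi>"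
proof -
  define D :: "real^'v \<Rightarrow> 'v \<Rightarrow> real" where "D u x = u $ x / sqrt (\<mu> x)" for u x
  define f :: "real^'v \<Rightarrow> real^'v" where
    "f u = (\<chi> x. sqrt (\<mu> x) * - laplacian adj \<mu> w (D u) x)" for u
  define a where "a x y = (if adj x y then w x y else 0)" for x y
  have a_sym: "a x y = a y x" for x y
    using undirected weight_sym by (auto simp: a_def dest: sympD)
  have f_alt: "f u $ x = (\<Sum>y\<in>UNIV. a x y * (D u x - D u y)) / sqrt (\<mu> x)" for u x
  proof -
    have "(\<Sum>y | adj x y. w x y * (D u y - D u x)) = (\<Sum>y\<in>UNIV. a x y * (D u y - D u x))"
      by (intro sum.mono_neutral_cong_left) (auto simp: a_def)
    also have "\<dots> = - (\<Sum>y\<in>UNIV. a x y * (D u x - D u y))"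
      by (simp add: right_diff_distrib sum_subtractf)
    finally show ?thesis
      using measure_pos[of x] by (simp add: f_def laplacian_def sqrt_divide_self_eq divide_simps)
  qed
  have "linear f"
  proof (rule linearI)
    fix u v :: "real^'v" and r :: real
    have "D (u + v) x = D u x + D v x" "D (r *\<^sub>R u) x = r * D u x" for x
      by (simp_all add: D_def add_divide_distrib)
    then show "f (u + v) = f u + f v" "f (r *\<^sub>R u) = r *\<^sub>R f u"
      by (simp_all add: vec_eq_iff f_alt distrib_left right_diff_distrib sum.distrib sum_subtractf
          add_divide_distrib diff_divide_distrib sum_distrib_left mult.left_commute)
  qed
  moreover have "f u \<bullet> v = u \<bullet> f v" for u v
  proof -
    have 1: "f u \<bullet> v = (\<Sum>x\<in>UNIV. \<Sum>y\<in>UNIV. a x y * (D u x - D u y) * D v x)" for u v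
      by (simp add: inner_vec_def f_alt D_def sum_distrib_right sum_divide_distrib)
    have 2: "2 * (f u \<bullet> v) = (\<Sum>x\<in>UNIV. \<Sum>y\<in>UNIV. a x y * (D u x - D u y) * (D v x - D v y))"
      for u v
    proof -
      have "f u \<bullet> v = (\<Sum>x\<in>UNIV. \<Sum>y\<in>UNIV. a x y * (D u y - D u x) * D v y)"
        unfolding 1 by (subst sum.swap) (simp add: a_sym)
      then have "2 * (f u \<bullet> v) = (\<Sum>x\<in>UNIV. \<Sum>y\<in>UNIV. a x y * (D u x - D u y) * D v x) +
          (\<Sum>x\<in>UNIV. \<Sum>y\<in>UNIV. a x y * (D u y - D u x) * D v y)"
        using 1[of u v] by linarith
      then show ?thesis by (simp add: sum.distrib[symmetric] algebra_simps)
    qed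
    have "2 * (f u \<bullet> v) = 2 * (f v \<bullet> u)"
      unfolding 2 by (simp add: mult_ac)
    then show ?thesis by (simp add: inner_commute)
  qed
  ultimately have "\<exists>e l. mono_on {..<CARD('v)} l \<and>
      (\<forall>i<CARD('v). e i \<in> UNIV \<and> f (e i) = l i *\<^sub>R e i) \<and>
      (\<forall>i<CARD('v). \<forall>j<CARD('v). e i \<bullet> e j = (if i = j then 1 else (0::real)))"
    by (intro self_adjoint_eigenbasis) auto
  then obtain e l where el: "mono_on {..<CARD('v)} l"
    "\<And>i. i < CARD('v) \<Longrightarrow> f (e i) = l i *\<^sub>R e i"
    "\<And>i j. i < CARD('v) \<Longrightarrow> j < CARD('v) \<Longrightarrow> e i \<bullet> e j = (if i = j then 1 else (0::real))"
    by blast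
  have "- laplacian adj \<mu> w (D (e i)) x = l i * D (e i) x" if "i < CARD('v)" for i x
  proof -
    have "sqrt (\<mu> x) * - laplacian adj \<mu> w (D (e i)) x = l i * e i $ x"
      using arg_cong[OF el(2)[OF that], of "\<lambda>v. v $ x"] by (simp add: f_def)
    then show ?thesis using measure_pos[of x] by (simp add: D_def field_simps)
  qed
  moreover have "vertex_inner \<mu> (D u) (D v) = u \<bullet> v" for u v
    unfolding vertex_inner_def inner_vec_def
  proof (rule sum.cong)
    fix x show "\<mu> x * D u x * D v x = u $ x \<bullet> v $ x"
      using measure_pos[of x] real_sqrt_mult_self[of "\<mu> x"] by (simp add: D_def field_simps)
  qed simp
  ultimately have "eigensystem adj \<mu> w l (\<lambda>i. D (e i))"
    using el by (simp add: eigensystem_def)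
  then show ?thesis by blast
qed

end

theory Submission
  imports Defs
begin

text \<open>
  Eigenfunctions with nonzero eigenvalue have mean zero, so the rows of \<open>W\<^sub>s\<close>, its diagonal given by the
  same formula, sum to zero. Hence the Dirichlet energy diagonalises as
  \<open>\<Sum>i. \<lambda>\<^sub>i\<^sup>s \<langle>u, \<phi>\<^sub>i\<rangle>\<^sup>2\<close>, which by Parseval and connectedness controls the squared norm of mean-zero
  functions. As \<open>log \<integral> h e\<^sup>u\<close> differs from \<open>log \<integral> h\<close> by at most \<open>max \<bar>u\<bar>\<close>, the functional is coercive
  whatever the sign of \<open>\<rho>\<close>, so a minimizer exists by compactness. Testing the first variation at the
  minimizer with the residual of the equation, itself a mean-zero function, makes the residual vanish.
\<close>

section \<open>Minimization of coercive functions\<close>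

text \<open>The quadratic lower bound keeps \<open>F\<close> at or above \<open>F z\<close> outside
  a large ball, so the minimum over the compact part of \<open>S\<close> inside the ball is
  global.\<close>

lemma continuous_coercive_attains_min:
  fixes F :: "'a::euclidean_space \<Rightarrow> real"
  assumes S: "closed S" "z \<in> S" and cont: "continuous_on S F" and "c > 0"
    and low: "\<And>v. v \<in> S \<Longrightarrow> c * (norm v)\<^sup>2 - b * norm v - d \<le> F v"
  shows "\<exists>u\<in>S. \<forall>v\<in>S. F u \<le> F v"
proof -
  \<comment> \<open>Beyond this radius \<open>norm v\<close> is at least 1 and
    \<open>c * norm v - b\<close> is at least \<open>\<bar>d\<bar> + \<bar>F z\<bar>\<close>, so
    their product dominates \<open>d + F z\<close>. The maximum with \<open>norm z\<close> keeps
    \<open>z\<close> in the ball.\<close>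
  define R where "R = max (norm z) (1 + (\<bar>b\<bar> + \<bar>d\<bar> + \<bar>F z\<bar>) / c)"
  have far: "F z \<le> F v" if v: "v \<in> S" "norm v > R" for v
  proof -
    let ?t = "norm v"
    have t: "?t \<ge> 1 + (\<bar>b\<bar> + \<bar>d\<bar> + \<bar>F z\<bar>) / c" using v by (simp add: R_def)
    then have "c * ?t \<ge> c + (\<bar>b\<bar> + \<bar>d\<bar> + \<bar>F z\<bar>)" using \<open>c > 0\<close> by (simp add: field_simps)
    moreover have "0 \<le> (\<bar>b\<bar> + \<bar>d\<bar> + \<bar>F z\<bar>) / c" using \<open>c > 0\<close> by simp
    then have t1: "?t \<ge> 1" using t by linarith
    ultimately have "1 * (\<bar>d\<bar> + \<bar>F z\<bar>) \<le> ?t * (c * ?t - b)"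
      using \<open>c > 0\<close> by (intro mult_mono) auto
    then have "F z \<le> c * ?t\<^sup>2 - b * ?t - d" by (simp add: power2_eq_square algebra_simps)
    then show ?thesis using low[OF v(1)] by linarith
  qed
  have "compact (S \<inter> cball 0 R)" using S(1) by (intro closed_Int_compact) auto
  moreover have z: "z \<in> S \<inter> cball 0 R" using S(2) by (simp add: R_def)
  moreover have "continuous_on (S \<inter> cball 0 R) F" using cont by (rule continuous_on_subset) auto
  ultimately obtain u where u: "u \<in> S \<inter> cball 0 R" "\<And>v. v \<in> S \<inter> cball 0 R \<Longrightarrow> F u \<le> F v"
    using continuous_attains_inf[of "S \<inter> cball 0 R" F] by blast
  have "F u \<le> F v" if "v \<in> S" for v
  proof (cases "norm v \<le> R")
    case True
    then show ?thesis using u(2) that by simp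
  next
    case False
    then show ?thesis using far[of v] u(2)[OF z] that by simp
  qed
  then show ?thesis using u(1) by blast
qed

section \<open>Green's identity and harmonic functions\<close>

text \<open>Discrete integration by parts: exchanging the names of \<open>x\<close> and
  \<open>y\<close> and adding symmetrizes the right side. It serves both the edge weights and the
  fractional kernel.\<close>

lemma sum_symmetric_bilinear:
  fixes a :: "'v::finite \<Rightarrow> 'v \<Rightarrow> real"
  assumes sym: "\<And>x y. a x y = a y x"
  shows "(\<Sum>x\<in>UNIV. \<Sum>y\<in>UNIV. a x y * (u x - u y) * (v x - v y)) =
    2 * (\<Sum>x\<in>UNIV. (\<Sum>y\<in>UNIV. a x y * (u x - u y)) * v x)"
proof -
  let ?S = "\<Sum>x\<in>UNIV. \<Sum>y\<in>UNIV. a x y * (u x - u y) * v x"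
  have "?S = (\<Sum>x\<in>UNIV. \<Sum>y\<in>UNIV. a x y * (u y - u x) * v y)"
    by (subst sum.swap) (simp add: sym)
  then have "2 * ?S = ?S + (\<Sum>x\<in>UNIV. \<Sum>y\<in>UNIV. a x y * (u y - u x) * v y)" by linarith
  also have "\<dots> = (\<Sum>x\<in>UNIV. \<Sum>y\<in>UNIV. a x y * (u x - u y) * (v x - v y))"
    by (simp add: sum.distrib[symmetric] algebra_simps)
  finally show ?thesis by (simp add: sum_distrib_right)
qed

text \<open>Weights are symmetric by assumption only on edges; extending them by zero gives a kernel
  symmetric on all pairs, to which summation by parts applies.\<close>

lemma (in weighted_graph) sum_neg_laplacian_mult:
  "2 * (\<Sum>x\<in>UNIV. \<mu> x * - laplacian adj \<mu> w u x * v x) =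
    (\<Sum>x\<in>UNIV. \<Sum>y\<in>UNIV. (if adj x y then w x y else 0) * (u x - u y) * (v x - v y))"
proof -
  define a where "a x y = (if adj x y then w x y else 0)" for x y
  have a_sym: "a x y = a y x" for x y
    using undirected weight_sym by (auto simp: a_def dest: sympD)
  have "\<mu> x * - laplacian adj \<mu> w u x = (\<Sum>y\<in>UNIV. a x y * (u x - u y))" for x
  proof -
    have "\<mu> x * - laplacian adj \<mu> w u x = (\<Sum>y | adj x y. w x y * (u x - u y))"
      using measure_pos[of x]
      by (simp add: laplacian_def right_diff_distrib sum_subtractf)
    also have "\<dots> = (\<Sum>y\<in>UNIV. a x y * (u x - u y))"
      by (intro sum.mono_neutral_cong_left) (auto simp: a_def)
    finally show ?thesis .
  qed
  then show ?thesis using sum_symmetric_bilinear[of a u v] a_sym by (simp add: a_def)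
qed

lemma (in weighted_graph) vertex_integral_laplacian: "vertex_integral \<mu> (laplacian adj \<mu> w u) = 0"
  using sum_neg_laplacian_mult[of u "\<lambda>_. 1"] by (simp add: vertex_integral_def sum_negf)

text \<open>Pairing the Laplacian of \<open>u\<close> with \<open>u\<close> makes a sum of
  nonnegative edge terms vanish, so \<open>u\<close> agrees across every edge and, by connectedness,
  everywhere.\<close>

lemma (in weighted_graph) harmonic_imp_constant:
  assumes "\<And>x. laplacian adj \<mu> w u x = 0"
  shows "u x = u y"
proof -
  let ?e = "\<lambda>x y. (if adj x y then w x y else 0) * (u x - u y) * (u x - u y)"
  have nonneg: "?e x y \<ge> 0" for x y using weight_pos[of x y] by (simp add: mult.assoc less_imp_le)
  have "(\<Sum>x\<in>UNIV. \<Sum>y\<in>UNIV. ?e x y) = 0"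
    using sum_neg_laplacian_mult[of u u] assms by simp
  then have "?e x y = 0" for x y
    using nonneg by (simp add: sum_nonneg_eq_0_iff sum_nonneg)
  then have edge: "u x = u y" if "adj x y" for x y
    using that weight_pos[of x y] by (metis mult_eq_0_iff less_irrefl eq_iff_diff_eq_0)
  show ?thesis using connected[of x y] by induction (auto dest: edge)
qed

section \<open>Eigenfunctions: means, completeness, Parseval\<close>

lemma eigensystemD:
  fixes \<mu> :: "'v::finite \<Rightarrow> real"
  assumes "eigensystem adj \<mu> w lam \<phi>" "i < CARD('v)"
  shows "- laplacian adj \<mu> w (\<phi> i) x = lam i * \<phi> i x"
    and "j < CARD('v) \<Longrightarrow> vertex_inner \<mu> (\<phi> i) (\<phi> j) = (if i = j then 1 else 0)"
  using assms by (auto simp: eigensystem_def)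

text \<open>Integrating the eigenvalue equation leaves the integral of a Laplacian, which is 0. The
  factor \<open>lam i\<close> stays because the constant eigenfunction has nonzero mean.\<close>

lemma (in weighted_graph) vertex_integral_eigenfunction:
  assumes "eigensystem adj \<mu> w lam \<phi>" "i < CARD('v)"
  shows "lam i * vertex_integral \<mu> (\<phi> i) = 0"
proof -
  have "lam i * vertex_integral \<mu> (\<phi> i) = (\<Sum>x\<in>UNIV. \<mu> x * (lam i * \<phi> i x))"
    by (simp add: vertex_integral_def sum_distrib_left mult_ac)
  also have "\<dots> = - vertex_integral \<mu> (laplacian adj \<mu> w (\<phi> i))"
    unfolding eigensystemD(1)[OF assms, symmetric] by (simp add: vertex_integral_def sum_negf)
  finally show ?thesis by (simp add: vertex_integral_laplacian)
qed

text \<open>Orthonormality of as many functions as there are vertices says that one square matrix is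
  a left inverse of another; it is then also a right inverse, which is the dual relation.\<close>

lemma orthonormal_completeness:
  fixes \<mu> :: "'v::finite \<Rightarrow> real" and \<phi> :: "nat \<Rightarrow> 'v \<Rightarrow> real"
  assumes "\<And>i j. i < CARD('v) \<Longrightarrow> j < CARD('v) \<Longrightarrow>
    vertex_inner \<mu> (\<phi> i) (\<phi> j) = (if i = j then 1 else 0)"
  shows "\<mu> y * (\<Sum>i<CARD('v). \<phi> i x * \<phi> i y) = (if x = y then 1 else 0)"
proof -
  obtain e :: "'v \<Rightarrow> nat" where e: "bij_betw e UNIV {..<CARD('v)}"
    using ex_bij_betw_finite_nat[of "UNIV :: 'v set"] by (auto simp: atLeast0LessThan)
  then have lt: "e a < CARD('v)" for a by (auto dest: bij_betwE)
  have inj: "e a = e b \<longleftrightarrow> a = b" for a b using e by (auto simp: bij_betw_def inj_on_def)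
  \<comment> \<open>Rows and columns are both indexed by vertices, with \<open>e\<close> turning a
    vertex into an index. Putting \<open>\<mu>\<close> into \<open>A\<close> alone makes
    \<open>A ** B\<close> the Gram matrix.\<close>
  define A B :: "real^'v^'v" where "A = (\<chi> a x. \<mu> x * \<phi> (e a) x)" and "B = (\<chi> x a. \<phi> (e a) x)"
  have "A ** B = mat 1"
    using assms[OF lt lt]
    by (simp add: A_def B_def matrix_matrix_mult_def mat_def vec_eq_iff vertex_inner_def inj)
  then have "B ** A = mat 1" by (simp add: matrix_left_right_inverse)
  then have "(\<Sum>a\<in>UNIV. \<phi> (e a) x * (\<mu> y * \<phi> (e a) y)) = (if x = y then 1 else 0)"
    by (simp add: A_def B_def matrix_matrix_mult_def mat_def vec_eq_iff)
  also have "(\<Sum>a\<in>UNIV. \<phi> (e a) x * (\<mu> y * \<phi> (e a) y)) =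
      (\<Sum>i<CARD('v). \<phi> i x * (\<mu> y * \<phi> i y))"
    by (rule sum.reindex_bij_betw[OF e])
  finally show ?thesis by (simp add: sum_distrib_left mult_ac)
qed

text \<open>Once the squares are expanded and the sum over \<open>i\<close> is innermost,
  completeness collapses it to the diagonal.\<close>

lemma orthonormal_Parseval:
  fixes \<mu> :: "'v::finite \<Rightarrow> real" and \<phi> :: "nat \<Rightarrow> 'v \<Rightarrow> real"
  assumes "\<And>i j. i < CARD('v) \<Longrightarrow> j < CARD('v) \<Longrightarrow>
    vertex_inner \<mu> (\<phi> i) (\<phi> j) = (if i = j then 1 else 0)"
  shows "(\<Sum>i<CARD('v). (vertex_inner \<mu> u (\<phi> i))\<^sup>2) = vertex_inner \<mu> u u"
proof -
  have "(\<Sum>i<CARD('v). (vertex_inner \<mu> u (\<phi> i))\<^sup>2) =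
      (\<Sum>i<CARD('v). \<Sum>x\<in>UNIV. \<Sum>y\<in>UNIV. \<mu> x * u x * \<phi> i x * (\<mu> y * u y * \<phi> i y))"
    by (simp add: vertex_inner_def power2_eq_square sum_product)
  also have "\<dots> = (\<Sum>x\<in>UNIV. \<Sum>y\<in>UNIV. \<Sum>i<CARD('v). \<mu> x * u x * \<phi> i x * (\<mu> y * u y * \<phi> i y))"
    by (subst sum.swap, subst (2) sum.swap) simp
  also have "\<dots> = (\<Sum>x\<in>UNIV. \<Sum>y\<in>UNIV. \<mu> x * u x * u y * (\<mu> y * (\<Sum>i<CARD('v). \<phi> i x * \<phi> i y)))"
    by (simp add: sum_distrib_left mult_ac)
  also have "\<dots> = vertex_inner \<mu> u u"
    by (simp add: orthonormal_completeness[OF assms] vertex_inner_def if_distrib cong: if_cong)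
  finally show ?thesis .
qed

section \<open>Fractional Laplacian and its energy\<close>

lemma frac_weight_sym: "frac_weight \<mu> lam \<phi> s x y = frac_weight \<mu> lam \<phi> s y x"
  by (simp add: frac_weight_def mult_ac)

text \<open>The term \<open>y = x\<close> vanishes whatever the diagonal value of the kernel, so the
  sum may run over all vertices.\<close>

lemma frac_laplacian_mult_measure:
  assumes "\<And>x. \<mu> x > 0"
  shows "\<mu> x * frac_laplacian \<mu> lam \<phi> s u x =
    (\<Sum>y\<in>UNIV. frac_weight \<mu> lam \<phi> s x y * (u x - u y))"
proof -
  have "\<mu> x * frac_laplacian \<mu> lam \<phi> s u x =
      (\<Sum>y | y \<noteq> x. frac_weight \<mu> lam \<phi> s x y * (u x - u y))"
    using assms[of x] by (simp add: frac_laplacian_def)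
  also have "\<dots> = (\<Sum>y\<in>UNIV. frac_weight \<mu> lam \<phi> s x y * (u x - u y))"
    by (intro sum.mono_neutral_left) auto
  finally show ?thesis .
qed

text \<open>The Dirichlet energy; the quadratic term of \<open>J_functional\<close> is half of
  it.\<close>

definition frac_energy ::
  "('v::finite \<Rightarrow> real) \<Rightarrow> (nat \<Rightarrow> real) \<Rightarrow> (nat \<Rightarrow> 'v \<Rightarrow> real) \<Rightarrow> real \<Rightarrow> ('v \<Rightarrow> real) \<Rightarrow> real" where
  "frac_energy \<mu> lam \<phi> s u = vertex_integral \<mu> (frac_grad_sq \<mu> lam \<phi> s u)"

lemma frac_energy_double_sum:
  assumes "\<And>x. \<mu> x > 0"
  shows "frac_energy \<mu> lam \<phi> s u =
    (\<Sum>x\<in>UNIV. \<Sum>y\<in>UNIV. frac_weight \<mu> lam \<phi> s x y * (u x - u y)\<^sup>2) / 2"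
proof -
  have "\<mu> x * frac_grad_sq \<mu> lam \<phi> s u x =
      (\<Sum>y\<in>UNIV. frac_weight \<mu> lam \<phi> s x y * (u x - u y)\<^sup>2) / 2" for x
  proof -
    have "\<mu> x * frac_grad_sq \<mu> lam \<phi> s u x =
        (\<Sum>y | y \<noteq> x. frac_weight \<mu> lam \<phi> s x y * (u x - u y)\<^sup>2) / 2"
      using assms[of x] by (simp add: frac_grad_sq_def)
    also have "(\<Sum>y | y \<noteq> x. frac_weight \<mu> lam \<phi> s x y * (u x - u y)\<^sup>2) =
        (\<Sum>y\<in>UNIV. frac_weight \<mu> lam \<phi> s x y * (u x - u y)\<^sup>2)"
      by (intro sum.mono_neutral_left) auto
    finally show ?thesis .
  qed
  then show ?thesis by (simp add: frac_energy_def vertex_integral_def sum_divide_distrib)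
qed

lemma frac_green_identity:
  assumes "\<And>x. \<mu> x > 0"
  shows "(\<Sum>x\<in>UNIV. \<Sum>y\<in>UNIV. frac_weight \<mu> lam \<phi> s x y * (u x - u y) * (v x - v y)) =
    2 * vertex_inner \<mu> (frac_laplacian \<mu> lam \<phi> s u) v"
  using sum_symmetric_bilinear[of "frac_weight \<mu> lam \<phi> s" u v]
  by (simp add: frac_weight_sym frac_laplacian_mult_measure assms vertex_inner_def)

lemma vertex_integral_frac_laplacian:
  assumes "\<And>x. \<mu> x > 0"
  shows "vertex_integral \<mu> (frac_laplacian \<mu> lam \<phi> s u) = 0"
  using frac_green_identity[OF assms, where u = u and v = "\<lambda>_. 1"]
  by (simp add: vertex_inner_def vertex_integral_def)

text \<open>The energy is a quadratic form, so the expansion in \<open>t\<close> is exact; Green's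
  identity rewrites the cross term. This supplies the first variation.\<close>

lemma frac_energy_add_scale:
  assumes "\<And>x. \<mu> x > 0"
  shows "frac_energy \<mu> lam \<phi> s (\<lambda>x. u x + t * v x) = frac_energy \<mu> lam \<phi> s u +
    2 * t * vertex_inner \<mu> (frac_laplacian \<mu> lam \<phi> s u) v + t\<^sup>2 * frac_energy \<mu> lam \<phi> s v"
proof -
  let ?W = "frac_weight \<mu> lam \<phi> s"
  have "?W x y * (u x + t * v x - (u y + t * v y))\<^sup>2 = ?W x y * (u x - u y)\<^sup>2 +
      2 * t * (?W x y * (u x - u y) * (v x - v y)) + t\<^sup>2 * (?W x y * (v x - v y)\<^sup>2)" for x y
    by algebra
  then have "(\<Sum>x\<in>UNIV. \<Sum>y\<in>UNIV. ?W x y * (u x + t * v x - (u y + t * v y))\<^sup>2) =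
      (\<Sum>x\<in>UNIV. \<Sum>y\<in>UNIV. ?W x y * (u x - u y)\<^sup>2) +
      2 * t * (\<Sum>x\<in>UNIV. \<Sum>y\<in>UNIV. ?W x y * (u x - u y) * (v x - v y)) +
      t\<^sup>2 * (\<Sum>x\<in>UNIV. \<Sum>y\<in>UNIV. ?W x y * (v x - v y)\<^sup>2)"
    by (simp add: sum.distrib sum_distrib_left)
  then show ?thesis
    by (simp add: frac_energy_double_sum[OF assms] frac_green_identity[OF assms] add_divide_distrib)
qed

lemma (in weighted_graph) frac_energy_spectral:
  assumes eig: "eigensystem adj \<mu> w lam \<phi>"
  shows "frac_energy \<mu> lam \<phi> s u = (\<Sum>i<CARD('v). lam i powr s * (vertex_inner \<mu> u (\<phi> i))\<^sup>2)"
proof -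
  let ?W = "frac_weight \<mu> lam \<phi> s"
  have rows: "(\<Sum>y\<in>UNIV. ?W x y) = 0" for x
  proof -
    have "(\<Sum>y\<in>UNIV. ?W x y) =
        (\<Sum>y\<in>UNIV. \<Sum>i<CARD('v). - \<mu> x * (lam i powr s * \<phi> i x * (\<mu> y * \<phi> i y)))"
      by (simp add: frac_weight_def sum_distrib_left mult_ac)
    also have "\<dots> =
        (\<Sum>i<CARD('v). - \<mu> x * (lam i powr s * \<phi> i x * vertex_integral \<mu> (\<phi> i)))"
      by (subst sum.swap) (simp add: vertex_integral_def sum_distrib_left sum_negf)
    \<comment> \<open>If \<open>lam i = 0\<close>, then \<open>0 powr s\<close> is 0; otherwise the
      mean of \<open>\<phi> i\<close> is 0.\<close>
    also have "\<dots> = 0"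
      using vertex_integral_eigenfunction[OF eig] by (intro sum.neutral) auto
    finally show ?thesis .
  qed
  have "frac_energy \<mu> lam \<phi> s u = (\<Sum>x\<in>UNIV. (\<Sum>y\<in>UNIV. ?W x y * (u x - u y)) * u x)"
    using sum_symmetric_bilinear[of ?W u u]
    by (simp add: frac_energy_double_sum measure_pos power2_eq_square frac_weight_sym mult.assoc)
  \<comment> \<open>By \<open>rows\<close> the \<open>u x\<close> contributions cancel, leaving the
    form with kernel \<open>- ?W\<close> on all pairs, diagonal included, as the spectral sum
    requires.\<close>
  also have "\<dots> = (\<Sum>x\<in>UNIV. (\<Sum>y\<in>UNIV. - ?W x y * u y) * u x)"
    by (simp add: right_diff_distrib sum_subtractf sum_distrib_right[symmetric] rows sum_negf)
  also have "\<dots> = (\<Sum>x\<in>UNIV. \<Sum>y\<in>UNIV. \<Sum>i<CARD('v).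
      lam i powr s * ((\<mu> x * u x * \<phi> i x) * (\<mu> y * u y * \<phi> i y)))"
    by (simp add: frac_weight_def sum_distrib_left sum_distrib_right sum_negf mult_ac)
  also have "\<dots> = (\<Sum>i<CARD('v). \<Sum>x\<in>UNIV. \<Sum>y\<in>UNIV.
      lam i powr s * ((\<mu> x * u x * \<phi> i x) * (\<mu> y * u y * \<phi> i y)))"
    by (subst sum.swap, subst (2) sum.swap) simp
  also have "\<dots> = (\<Sum>i<CARD('v). lam i powr s * (vertex_inner \<mu> u (\<phi> i))\<^sup>2)"
    by (simp add: vertex_inner_def power2_eq_square sum_product)
      (simp add: sum_distrib_left)
  finally show ?thesis .
qed

lemma (in weighted_graph) frac_energy_Poincare:
  assumes eig: "eigensystem adj \<mu> w lam \<phi>"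
  shows "\<exists>c>0. \<forall>u. vertex_integral \<mu> u = 0 \<longrightarrow>
    c * vertex_inner \<mu> u u \<le> frac_energy \<mu> lam \<phi> s u"
proof -
  define I where "I = {i. i < CARD('v) \<and> lam i \<noteq> 0}"
  \<comment> \<open>The entry 1 keeps the set nonempty. As \<open>powr\<close> is positive at every
    nonzero base, \<open>c\<close> is positive.\<close>
  define c where "c = Min (insert 1 ((\<lambda>i. lam i powr s) ` I))"
  have fin: "finite I" by (simp add: I_def)
  have "c > 0" using fin by (simp add: c_def I_def)
  have c: "c \<le> lam i powr s" if "i < CARD('v)" "lam i \<noteq> 0" for i
    unfolding c_def using fin that by (intro Min_le) (auto simp: I_def)
  have "c * vertex_inner \<mu> u u \<le> frac_energy \<mu> lam \<phi> s u" if u: "vertex_integral \<mu> u = 0" for u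
  proof -
    have "c * (vertex_inner \<mu> u (\<phi> i))\<^sup>2 \<le> lam i powr s * (vertex_inner \<mu> u (\<phi> i))\<^sup>2"
      if i: "i < CARD('v)" for i
    proof (cases "lam i = 0")
      \<comment> \<open>A zero mode is harmonic, hence constant, so the coefficient of
        \<open>u\<close> along it is a multiple of the integral of \<open>u\<close>, which is 0.
        Here \<open>undefined\<close> serves as a fixed vertex.\<close>
      case True
      then have const: "\<phi> i x = \<phi> i undefined" for x
        using eigensystemD(1)[OF eig i] by (intro harmonic_imp_constant) simp
      have "vertex_inner \<mu> u (\<phi> i) = vertex_integral \<mu> u * \<phi> i undefined"
        unfolding vertex_inner_def vertex_integral_def sum_distrib_right
        by (intro sum.cong refl) (subst const, rule refl)
      then show ?thesis by (simp add: u)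
    next
      case False
      then show ?thesis by (intro mult_right_mono c i) auto
    qed
    then have "c * (\<Sum>i<CARD('v). (vertex_inner \<mu> u (\<phi> i))\<^sup>2) \<le> frac_energy \<mu> lam \<phi> s u"
      unfolding frac_energy_spectral[OF eig] sum_distrib_left by (intro sum_mono) auto
    then show ?thesis by (simp add: orthonormal_Parseval eigensystemD(2)[OF eig])
  qed
  then show ?thesis using \<open>c > 0\<close> by blast
qed

section \<open>Coercivity and existence of a minimizer\<close>

lemma vertex_integral_mono:
  assumes "\<And>x. \<mu> x > 0" "\<And>x. f x \<le> g x"
  shows "vertex_integral \<mu> f \<le> vertex_integral \<mu> g"
  unfolding vertex_integral_def
  using assms by (intro sum_mono mult_left_mono) (auto intro: less_imp_le)

lemma vertex_integral_pos:
  assumes "\<And>x. \<mu> x > 0" "\<And>x. f x > 0"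
  shows "vertex_integral \<mu> f > 0"
  unfolding vertex_integral_def using assms by (intro sum_pos) auto

text \<open>Since \<open>exp (u x)\<close> lies between \<open>exp (- M)\<close> and
  \<open>exp M\<close>, the integral is that of \<open>h\<close> up to such a factor. The bound is
  two-sided because \<open>\<rho>\<close> may have either sign.\<close>

lemma ln_vertex_integral_exp_bound:
  assumes \<mu>: "\<And>x. \<mu> x > 0" and h: "\<And>x. h x > 0" and M: "\<And>x. \<bar>u x\<bar> \<le> M"
  shows "\<bar>ln (vertex_integral \<mu> (\<lambda>x. h x * exp (u x)))\<bar> \<le> \<bar>ln (vertex_integral \<mu> h)\<bar> + M"
proof -
  let ?I = "vertex_integral \<mu> (\<lambda>x. h x * exp (u x))" and ?H = "vertex_integral \<mu> h"
  have scale: "vertex_integral \<mu> (\<lambda>x. h x * exp a) = ?H * exp a" for a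
    by (simp add: vertex_integral_def sum_distrib_right mult.assoc)
  have H: "?H > 0" and I: "?I > 0" using \<mu> h by (auto intro!: vertex_integral_pos)
  have "?I \<le> vertex_integral \<mu> (\<lambda>x. h x * exp M)"
    using M h by (intro vertex_integral_mono \<mu> mult_left_mono) (auto simp: abs_le_iff less_imp_le)
  then have "ln ?I \<le> ln (?H * exp M)" using H I by (simp add: scale)
  moreover have "- M \<le> u x" for x using M[of x] by linarith
  then have "vertex_integral \<mu> (\<lambda>x. h x * exp (- M)) \<le> ?I"
    using h by (intro vertex_integral_mono \<mu> mult_left_mono) (auto simp: less_imp_le)
  then have "ln (?H * exp (- M)) \<le> ln ?I" using H I by (simp add: scale)
  ultimately show ?thesis using H by (simp add: ln_mult)
qed

text \<open>The Sobolev integral is a real number, so its finiteness is automatic and only the mean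
  condition remains.\<close>

lemma mem_mean_zero_sobolev: "u \<in> mean_zero_sobolev \<mu> lam \<phi> s \<longleftrightarrow> vertex_integral \<mu> u = 0"
  by (simp add: mean_zero_sobolev_def frac_sobolev_def)

lemma (in weighted_graph) J_functional_attains_min:
  assumes eig: "eigensystem adj \<mu> w lam \<phi>" and h: "\<And>x. h x > 0"
  shows "\<exists>u. vertex_integral \<mu> u = 0 \<and> (\<forall>v. vertex_integral \<mu> v = 0 \<longrightarrow>
    J_functional \<mu> lam \<phi> s h \<rho> u \<le> J_functional \<mu> lam \<phi> s h \<rho> v)"
proof -
  let ?J = "J_functional \<mu> lam \<phi> s h \<rho>"
  \<comment> \<open>Functions become vectors of \<open>real^'v\<close>, so that the compactness
    argument in Euclidean space applies.\<close>
  define S :: "(real^'v) set" where "S = {v. vertex_integral \<mu> (($) v) = 0}"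
  obtain c where c: "c > 0" and
    poincare: "\<And>u. vertex_integral \<mu> u = 0 \<Longrightarrow> c * vertex_inner \<mu> u u \<le> frac_energy \<mu> lam \<phi> s u"
    using frac_energy_Poincare[OF eig] by blast
  \<comment> \<open>The smallest vertex mass compares the weighted norm with the Euclidean
    one.\<close>
  define m where "m = Min (range \<mu>)"
  have m: "m > 0" "m \<le> \<mu> x" for x using measure_pos by (auto simp: m_def)
  have "closed S"
    unfolding S_def vertex_integral_def by (intro closed_Collect_eq continuous_intros)
  moreover have "0 \<in> S" by (simp add: S_def vertex_integral_def)
  moreover have "continuous_on S (\<lambda>v. ?J (($) v))"
    unfolding J_functional_def vertex_integral_def frac_grad_sq_def
  proof (intro continuous_intros ballI)
    fix v :: "real^'v"
    have "vertex_integral \<mu> (\<lambda>x. h x * exp (v $ x)) > 0"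
      using h by (intro vertex_integral_pos measure_pos) simp
    then show "(\<Sum>x\<in>UNIV. \<mu> x * (h x * exp (v $ x))) \<noteq> 0" by (simp add: vertex_integral_def)
  qed
  moreover have "c * m / 2 > 0" using c m by simp
  \<comment> \<open>The leading coefficient combines the Poincare constant, the mass bound and the
    factor 1/2 of the energy. The other terms bound the logarithm, with \<open>norm v\<close>
    dominating every component.\<close>
  moreover have "c * m / 2 * (norm v)\<^sup>2 - \<bar>\<rho>\<bar> * norm v - \<bar>\<rho>\<bar> * \<bar>ln (vertex_integral \<mu> h)\<bar>
      \<le> ?J (($) v)" if "v \<in> S" for v
  proof -
    let ?L = "ln (vertex_integral \<mu> (\<lambda>x. h x * exp (v $ x)))"
    have "m * (norm v)\<^sup>2 \<le> vertex_inner \<mu> (($) v) (($) v)"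
      unfolding dot_square_norm[symmetric] inner_vec_def vertex_inner_def sum_distrib_left
      using m by (intro sum_mono) (simp add: mult_right_mono mult.assoc)
    then have "c * (m * (norm v)\<^sup>2) \<le> frac_energy \<mu> lam \<phi> s (($) v)"
      using poincare[of "($) v"] that c by (smt (verit) S_def mem_Collect_eq mult_left_mono)
    moreover have "\<bar>?L\<bar> \<le> \<bar>ln (vertex_integral \<mu> h)\<bar> + norm v"
      by (intro ln_vertex_integral_exp_bound measure_pos h component_le_norm_cart)
    then have "\<bar>\<rho> * ?L\<bar> \<le> \<bar>\<rho>\<bar> * (\<bar>ln (vertex_integral \<mu> h)\<bar> + norm v)"
      unfolding abs_mult by (rule mult_left_mono) simp
    then have "\<rho> * ?L \<le> \<bar>\<rho>\<bar> * norm v + \<bar>\<rho>\<bar> * \<bar>ln (vertex_integral \<mu> h)\<bar>"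
      by (simp add: distrib_left)
    ultimately show ?thesis by (simp add: J_functional_def frac_energy_def)
  qed
  ultimately have "\<exists>u\<in>S. \<forall>v\<in>S. ?J (($) u) \<le> ?J (($) v)"
    by (rule continuous_coercive_attains_min)
  then obtain u where u: "u \<in> S" "\<And>v. v \<in> S \<Longrightarrow> ?J (($) u) \<le> ?J (($) v)" by blast
  have "?J (($) u) \<le> ?J v" if "vertex_integral \<mu> v = 0" for v
  proof -
    have "($) (\<chi> x. v x) = v" by (simp add: fun_eq_iff)
    then show ?thesis using u(2)[of "\<chi> x. v x"] that by (simp add: S_def)
  qed
  then show ?thesis using u(1) by (auto simp: S_def)
qed

section \<open>First variation and Euler-Lagrange equation\<close>

lemma J_functional_has_derivative_along_line:
  assumes \<mu>: "\<And>x. \<mu> x > 0" and h: "\<And>x. h x > 0"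
  shows "((\<lambda>t. J_functional \<mu> lam \<phi> s h \<rho> (\<lambda>x. u x + t * v x)) has_real_derivative
    vertex_inner \<mu> (\<lambda>x. frac_laplacian \<mu> lam \<phi> s u x -
      \<rho> * (h x * exp (u x) / vertex_integral \<mu> (\<lambda>y. h y * exp (u y)))) v) (at 0)"
proof -
  let ?I = "vertex_integral \<mu> (\<lambda>y. h y * exp (u y))"
  have I: "?I > 0" using h by (intro vertex_integral_pos \<mu>) simp
  let ?L = "\<lambda>t. ln (\<Sum>x\<in>UNIV. \<mu> x * (h x * exp (u x + t * v x)))"
  have L: "(?L has_real_derivative (\<Sum>x\<in>UNIV. \<mu> x * (h x * (exp (u x) * v x))) / ?I) (at 0)"
    using I by (auto intro!: derivative_eq_intros sum.cong simp: vertex_integral_def)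
  \<comment> \<open>The energy is a polynomial in \<open>t\<close>, so only the logarithm calls for
    the chain rule.\<close>
  have J: "J_functional \<mu> lam \<phi> s h \<rho> (\<lambda>x. u x + t * v x) =
      1 / 2 * (frac_energy \<mu> lam \<phi> s u + 2 * t * vertex_inner \<mu> (frac_laplacian \<mu> lam \<phi> s u) v
        + t\<^sup>2 * frac_energy \<mu> lam \<phi> s v) - \<rho> * ?L t" for t
    unfolding J_functional_def frac_energy_def[symmetric] frac_energy_add_scale[OF \<mu>]
    by (simp add: vertex_integral_def)
  have "((\<lambda>t. J_functional \<mu> lam \<phi> s h \<rho> (\<lambda>x. u x + t * v x)) has_real_derivative
      vertex_inner \<mu> (frac_laplacian \<mu> lam \<phi> s u) v -
      \<rho> * ((\<Sum>x\<in>UNIV. \<mu> x * (h x * (exp (u x) * v x))) / ?I)) (at 0)"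
    unfolding J by (rule derivative_eq_intros L refl | simp)+
  also have "vertex_inner \<mu> (frac_laplacian \<mu> lam \<phi> s u) v -
      \<rho> * ((\<Sum>x\<in>UNIV. \<mu> x * (h x * (exp (u x) * v x))) / ?I) =
      vertex_inner \<mu> (\<lambda>x. frac_laplacian \<mu> lam \<phi> s u x - \<rho> * (h x * exp (u x) / ?I)) v"
    by (simp add: vertex_inner_def sum_divide_distrib sum_distrib_left sum_subtractf[symmetric]
        algebra_simps)
  finally show ?thesis .
qed

lemma J_functional_Euler_Lagrange:
  assumes \<mu>: "\<And>x. \<mu> x > 0" and h: "\<And>x. h x > 0"
    and u: "vertex_integral \<mu> u = 0"
    and min: "\<And>v. vertex_integral \<mu> v = 0 \<Longrightarrow>
      J_functional \<mu> lam \<phi> s h \<rho> u \<le> J_functional \<mu> lam \<phi> s h \<rho> v"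
  shows "frac_laplacian \<mu> lam \<phi> s u x =
    \<rho> * (h x * exp (u x) / vertex_integral \<mu> (\<lambda>y. h y * exp (u y)) - 1 / total_volume \<mu>)"
proof -
  let ?I = "vertex_integral \<mu> (\<lambda>y. h y * exp (u y))"
  \<comment> \<open>\<open>g\<close> is the density of the first variation. The constant added in
    \<open>r\<close> is the Lagrange multiplier of the mean constraint: \<open>r\<close> is the
    residual of the equation and also an admissible direction.\<close>
  define g where "g x = frac_laplacian \<mu> lam \<phi> s u x - \<rho> * (h x * exp (u x) / ?I)" for x
  define r where "r x = g x + \<rho> / total_volume \<mu>" for x
  have I: "?I > 0" using h by (intro vertex_integral_pos \<mu>) simp
  have V: "total_volume \<mu> > 0" unfolding total_volume_def using \<mu> by (intro sum_pos) auto
  \<comment> \<open>The normalized density has integral 1 and the fractional Laplacian integral 0,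
    so \<open>g\<close> integrates to \<open>- \<rho>\<close>.\<close>
  have "(\<Sum>x\<in>UNIV. \<mu> x * (\<rho> * (h x * exp (u x) / ?I))) = \<rho> * (?I / ?I)"
    unfolding vertex_integral_def
    by (simp add: sum_distrib_left[symmetric] sum_divide_distrib[symmetric] mult.left_commute[of _ \<rho>])
  then have "vertex_integral \<mu> g = - \<rho>"
    using I vertex_integral_frac_laplacian[OF \<mu>, where u = u]
    by (simp add: g_def vertex_integral_def right_diff_distrib sum_subtractf)
  moreover have "vertex_integral \<mu> r = vertex_integral \<mu> g + \<rho> / total_volume \<mu> * total_volume \<mu>"
    by (simp add: r_def vertex_integral_def total_volume_def distrib_left sum.distrib
        sum_distrib_left sum_divide_distrib mult_ac)
  ultimately have r0: "vertex_integral \<mu> r = 0" using V by simp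
  \<comment> \<open>As \<open>r\<close> has mean zero, the whole line \<open>u + t * r\<close> is
    admissible and \<open>t = 0\<close> minimizes along it; the radius 1 is arbitrary.\<close>
  have "vertex_inner \<mu> g r = 0"
  proof (rule DERIV_local_min)
    show "((\<lambda>t. J_functional \<mu> lam \<phi> s h \<rho> (\<lambda>x. u x + t * r x)) has_real_derivative
        vertex_inner \<mu> g r) (at 0)"
      unfolding g_def by (rule J_functional_has_derivative_along_line[OF \<mu> h])
    show "\<forall>t. \<bar>0 - t\<bar> < 1 \<longrightarrow> J_functional \<mu> lam \<phi> s h \<rho> (\<lambda>x. u x + 0 * r x)
        \<le> J_functional \<mu> lam \<phi> s h \<rho> (\<lambda>x. u x + t * r x)"
    proof (intro allI impI)
      fix t :: real
      have "vertex_integral \<mu> (\<lambda>x. u x + t * r x) = vertex_integral \<mu> u + t * vertex_integral \<mu> r"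
        by (simp add: vertex_integral_def distrib_left sum.distrib sum_distrib_left mult_ac)
      then show "J_functional \<mu> lam \<phi> s h \<rho> (\<lambda>x. u x + 0 * r x)
          \<le> J_functional \<mu> lam \<phi> s h \<rho> (\<lambda>x. u x + t * r x)"
        using min[of "\<lambda>x. u x + t * r x"] u r0 by simp
    qed
  qed simp
  \<comment> \<open>\<open>r\<close> and \<open>g\<close> differ by a constant, which is orthogonal
    to the mean-zero \<open>r\<close>; hence the squared norm of \<open>r\<close> is 0.\<close>
  moreover have "vertex_inner \<mu> r r =
      vertex_inner \<mu> g r + \<rho> / total_volume \<mu> * vertex_integral \<mu> r"
    unfolding vertex_inner_def vertex_integral_def sum_distrib_left sum.distrib[symmetric]
    by (intro sum.cong refl) (subst (1) r_def, simp add: distrib_left distrib_right mult_ac)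
  ultimately have "(\<Sum>x\<in>UNIV. \<mu> x * r x * r x) = 0" using r0 by (simp add: vertex_inner_def)
  moreover have "\<mu> x * r x * r x \<ge> 0" for x using \<mu>[of x] by (simp add: mult.assoc)
  ultimately have "\<mu> x * r x * r x = 0" by (simp add: sum_nonneg_eq_0_iff)
  then have "r x = 0" using \<mu>[of x] by simp
  then show ?thesis by (simp add: r_def g_def right_diff_distrib)
qed

theorem theorem2p2:
  fixes adj :: "'v::finite \<Rightarrow> 'v \<Rightarrow> bool"
    and \<mu> h :: "'v \<Rightarrow> real"
    and w :: "'v \<Rightarrow> 'v \<Rightarrow> real"
    and lam :: "nat \<Rightarrow> real"
    and \<phi> :: "nat \<Rightarrow> 'v \<Rightarrow> real"
    and \<rho> s :: real
  assumes "weighted_graph adj \<mu> w"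
    and "eigensystem adj \<mu> w lam \<phi>"
    and "\<And>x. h x > 0"
    and "\<rho> \<in> {..<0} \<union> {0<..}"
    and "s \<in> {0<..<1}"
  shows "(\<exists>u \<in> mean_zero_sobolev \<mu> lam \<phi> s. \<forall>v \<in> mean_zero_sobolev \<mu> lam \<phi> s.
            J_functional \<mu> lam \<phi> s h \<rho> u \<le> J_functional \<mu> lam \<phi> s h \<rho> v) \<and>
         (\<exists>u \<in> mean_zero_sobolev \<mu> lam \<phi> s. \<forall>x.
            frac_laplacian \<mu> lam \<phi> s u x =
              \<rho> * (h x * exp (u x) / vertex_integral \<mu> (\<lambda>y. h y * exp (u y)) - 1 / total_volume \<mu>))"
proof -
  interpret weighted_graph adj \<mu> w by fact
  obtain u where u: "vertex_integral \<mu> u = 0" "\<And>v. vertex_integral \<mu> v = 0 \<Longrightarrow>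
      J_functional \<mu> lam \<phi> s h \<rho> u \<le> J_functional \<mu> lam \<phi> s h \<rho> v"
    using J_functional_attains_min[where h = h, OF assms(2,3)] by blast
  \<comment> \<open>The same minimizer witnesses both claims.\<close>
  then show ?thesis
    unfolding mem_mean_zero_sobolev Bex_def Ball_def
    using J_functional_Euler_Lagrange[OF measure_pos assms(3) u] by blast
qed

end
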